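(* Let $G$ be a block graph with $n\ge 2$ vertices, let $D(G)$ be its distance matrix, and for $0\le k\le n$ let $c_k(G)$ be the coefficient of $x^k$ in $\det(D(G)-xI)$. Then the sequence $(-1)^{n-1}c_0(G),\,(-1)^{n-1}c_1(G),\,\ldots,\,(-1)^{n-1}c_{n-2}(G)$ is unimodal.
   Context: Graphs are finite, undirected, simple, loopless and connected. The distance matrix $D(G)$ is indexed by the vertices of $G$, and its $(u,v)$-entry is the length of a shortest path between $u$ and $v$ in $G$. A block of $G$ is a maximal connected subgraph that has no cut vertices (of itself). A connected graph is a block graph if all of its blocks are cliques (complete graphs). A finite sequence $a_0,\ldots,a_N$ of real numbers is unimodal if there is an index $m$ such that $a_{i-1}\le a_i$ for all $1\le i\le m$ and $a_i\ge a_{i+1}$ for all $m\le i\le N-1$. *)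

theory Defs
  imports
    "Graph_Theory.Graph_Theory"
    "Jordan_Normal_Form.Determinant"
begin

text \<open>
  A finite simple undirected graph is a \<^term>\<open>graph G\<close> of the library: a finite, loop-free, symmetric
  digraph without parallel arcs, each undirected edge being represented by two opposite arcs.
  The name \<open>connected\<close> is qualified throughout because of the topological notion.
\<close>

text \<open>
  A cut vertex is one whose removal increases the number of connected components, i.e. which
  separates two other vertices of its component; so the one-vertex graph has none.
\<close>

definition cut_vertex :: "('a, 'b) pre_digraph \<Rightarrow> 'a \<Rightarrow> bool" where
  "cut_vertex G v \<longleftrightarrow> v \<in> verts G \<and>
     (\<exists>u \<in> verts G - {v}. \<exists>w \<in> verts G - {v}.
        u \<rightarrow>\<^sup>*\<^bsub>G\<^esub> w \<and> \<not> u \<rightarrow>\<^sup>*\<^bsub>pre_digraph.del_vert G v\<^esub> w)"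

text \<open>
  A subgraph in the library's sense need not be symmetric; the conjunct \<^term>\<open>graph H\<close> restricts
  both the block and its competitors to undirected subgraphs.
\<close>

definition is_block :: "('a, 'b) pre_digraph \<Rightarrow> ('a, 'b) pre_digraph \<Rightarrow> bool" where
  "is_block G B \<longleftrightarrow> pre_digraph.max_subgraph G
     (\<lambda>H. graph H \<and> Digraph_Component.connected H \<and> (\<nexists>v. cut_vertex H v)) B"

definition block_graph :: "('a, 'b) pre_digraph \<Rightarrow> bool" where
  "block_graph G \<longleftrightarrow> graph G \<and> Digraph_Component.connected G \<and>
     (\<forall>B. is_block G B \<longrightarrow> complete_digraph (card (verts B)) B)"

text \<open>
  \<open>\<mu>\<close> is the library's shortest-path distance; with unit weights it minimises the number of arcs.
  It takes values in \<^typ>\<open>ereal\<close> and is finite between vertices of a connected graph.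
\<close>

definition graph_dist :: "('a, 'b) pre_digraph \<Rightarrow> 'a \<Rightarrow> 'a \<Rightarrow> real" where
  "graph_dist G u v = real_of_ereal (wf_digraph.\<mu> G (\<lambda>_. 1) u v)"

text \<open>
  Matrices are indexed by \<open>{0..<n}\<close>, so the distance matrix is taken with respect to an enumeration
  \<open>vs\<close> of the vertices.
\<close>

definition distance_matrix :: "('a, 'b) pre_digraph \<Rightarrow> 'a list \<Rightarrow> real mat" where
  "distance_matrix G vs =
     mat (length vs) (length vs) (\<lambda>(i, j). graph_dist G (vs ! i) (vs ! j))"

text \<open>
  The polynomial \<open>det (A - x I)\<close>. The library's \<open>char_poly A\<close> is \<open>det (x I - A)\<close>, which differs from
  it by the sign \<open>(-1) ^ dim_row A\<close>.
\<close>

definition det_minus_x :: "real mat \<Rightarrow> real poly" where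
  "det_minus_x A =
     Determinant.det (map_mat (\<lambda>a. [:a:]) A - [:0, 1:] \<cdot>\<^sub>m 1\<^sub>m (dim_row A))"

text \<open>
  Unimodality of the finite sequence \<open>a 0, ..., a N\<close>; \<open>i < N\<close> stands for \<open>i \<le> N - 1\<close>, which would be
  wrong for \<open>N = 0\<close> with truncated subtraction.
\<close>

definition unimodal :: "nat \<Rightarrow> (nat \<Rightarrow> real) \<Rightarrow> bool" where
  "unimodal N a \<longleftrightarrow> (\<exists>m \<le> N.
     (\<forall>i. 1 \<le> i \<and> i \<le> m \<longrightarrow> a (i - 1) \<le> a i) \<and>
     (\<forall>i. m \<le> i \<and> i < N \<longrightarrow> a i \<ge> a (i + 1)))"

end

theory Submission
  imports Defs "Jordan_Normal_Form.Schur_Decomposition"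
begin

text \<open>
  The distance of a block graph is, up to the factor 2, a Hamming distance. Fix a root and attach to
  a vertex v the set of its ancestors in the breadth-first tree together with the set of those
  cliques of siblings which these ancestors belong to. One step along an edge changes exactly two of
  these features, and twice the distance of u and v is the size of the symmetric difference of their
  feature sets (\<open>dist_eq_half_features\<close>). The reason is that a cycle of the graph lies in a block and
  so spans a clique, which makes parents unique and partitions the children of a vertex into cliques.
  A Hamming distance is a sum of cuts, and a cut is a quadratic form that is at most 0 on vectors
  with coordinate sum 0. Hence \<open>D\<close> is negative semidefinite on that hyperplane
  (\<open>dist_conditionally_negative\<close>), where \<open>D\<close> is the distance matrix.

  Two positive eigenvalues of \<open>D\<close> would give a plane on which the form is positive definite, and
  this plane would contain a nonzero vector of the hyperplane. So all eigenvalues but one, \<open>l\<close>, are nonpositive, say \<open>- m\<^sub>i\<close>,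
  and \<open>l\<close> is the sum of the \<open>m\<^sub>i\<close> as the trace is 0. The sequence in question consists of the
  coefficients of \<open>(l - x) q\<close>, where \<open>q\<close> is the product of the \<open>x + m\<^sub>i\<close>. The polynomial has only real
  roots, so its coefficients are log-concave by Newton's inequality (\<open>log_concave_coeffs\<close>).
  Comparing neighbouring coefficients of \<open>q\<close> (\<open>linear_factors_coeff_ratio\<close>) shows that those of
  \<open>(l - x) q\<close> up to index \<open>n - 2\<close> are nonnegative, and positive from the first positive one on. A log-concave
  sequence of this kind is unimodal (\<open>unimodal_if_log_concave\<close>).
\<close>

section \<open>Newton's inequality and unimodality\<close>

definition real_split :: "real poly \<Rightarrow> bool" where
  "real_split p \<longleftrightarrow> (\<exists>c as. p = smult c (\<Prod>a\<leftarrow>as. [:- a, 1:]))"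

lemma map_poly_mult_of_real:
  "map_poly complex_of_real (p * q) = map_poly complex_of_real p * map_poly complex_of_real q"
  by (rule poly_eqI) (simp add: coeff_map_poly coeff_mult)

lemma complex_of_real_split_poly:
  "map_poly complex_of_real (\<Prod>a\<leftarrow>as. [:- a, 1:]) = (\<Prod>a\<leftarrow>as. [:- complex_of_real a, 1:])"
  by (induction as) (simp_all add: of_real_hom.map_poly_pCons_hom map_poly_mult_of_real del: mult_pCons_left)

text \<open>
  Real-rootedness is easiest to verify over the complex numbers, where roots always exist, and
  easiest to use as a factorization over the reals; this lemma passes from the one to the other.
\<close>

lemma splits_if_roots_real:
  fixes p :: "real poly"
  assumes "\<And>z. poly (map_poly complex_of_real p) z = 0 \<Longrightarrow> z \<in> \<real>"
  shows "\<exists>as. p = smult (lead_coeff p) (\<Prod>a\<leftarrow>as. [:- a, 1:])"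
proof -
  let ?P = "map_poly complex_of_real p"
  obtain zs where zs: "smult (lead_coeff ?P) (\<Prod>z\<leftarrow>zs. [:- z, 1:]) = ?P"
    using fundamental_theorem_algebra_factorized[of ?P] by blast
  have root: "poly ?P z = 0" if "z \<in> set zs" for z
  proof -
    have "poly (\<Prod>z\<leftarrow>zs. [:- z, 1:]) z = 0"
      using that by (induction zs) auto
    then show ?thesis by (subst zs[symmetric]) simp
  qed
  define as where "as = map Re zs"
  have "zs = map complex_of_real as"
    unfolding as_def using root assms by (auto simp: map_idI complex_is_Real_iff complex_eq_iff intro!: map_idI[symmetric])
  then have "?P = smult (complex_of_real (lead_coeff p)) (map_poly complex_of_real (\<Prod>a\<leftarrow>as. [:- a, 1:]))"
    using zs by (simp add: complex_of_real_split_poly o_def)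
  also have "\<dots> = map_poly complex_of_real (smult (lead_coeff p) (\<Prod>a\<leftarrow>as. [:- a, 1:]))"
    by (simp add: of_real_hom.map_poly_hom_smult)
  finally have eq: "map_poly complex_of_real p
      = map_poly complex_of_real (smult (lead_coeff p) (\<Prod>a\<leftarrow>as. [:- a, 1:]))" .
  have "p = smult (lead_coeff p) (\<Prod>a\<leftarrow>as. [:- a, 1:])"
  proof (rule poly_eqI)
    fix k
    show "coeff p k = coeff (smult (lead_coeff p) (\<Prod>a\<leftarrow>as. [:- a, 1:])) k"
      using arg_cong[OF eq, of "\<lambda>P. coeff P k"]
      by (simp only: coeff_map_poly of_real_0 of_real_eq_iff)
  qed
  then show ?thesis by blast
qed

text \<open>
  The logarithmic derivative of a product of linear factors. Nonreal \<open>z\<close> avoids all its roots.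
\<close>

lemma pderiv_split_eq_sum_reciprocals:
  fixes as :: "real list" and z :: complex
  assumes "z \<notin> \<real>"
  defines "P \<equiv> \<Prod>a\<leftarrow>as. [:- complex_of_real a, 1:]"
  shows "poly (pderiv P) z = poly P z * (\<Sum>a\<leftarrow>as. 1 / (z - complex_of_real a))"
  unfolding P_def
proof (induction as)
  case (Cons a as)
  have "z - complex_of_real a \<noteq> 0" using assms(1) by auto
  then show ?case using Cons by (simp add: pderiv_mult pderiv_pCons field_simps del: mult_pCons_left)
qed simp

lemma Im_sum_list: "Im (\<Sum>a\<leftarrow>as. f a) = (\<Sum>a\<leftarrow>as. Im (f a))"
  by (induction as) auto

text \<open>
  This is the Gauss-Lucas theorem for the real line. At a nonreal \<open>z\<close> all the reciprocals
  \<open>1 / (z - a)\<close> have imaginary parts of the same strict sign, so the logarithmic derivative does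
  not vanish there.
\<close>

lemma real_split_pderiv:
  assumes "real_split p"
  shows "real_split (pderiv p)"
proof -
  obtain c as where p: "p = smult c (\<Prod>a\<leftarrow>as. [:- a, 1:])"
    using assms unfolding real_split_def by blast
  let ?P = "\<Prod>a\<leftarrow>as. [:- complex_of_real a, 1:]"
  show ?thesis
  proof (cases "pderiv p = 0")
    case True
    then show ?thesis unfolding real_split_def by (intro exI[of _ 0]) simp
  next
    case False
    then have "c \<noteq> 0" and "as \<noteq> []" using p by (auto simp: pderiv_smult)
    have "z \<in> \<real>" if z: "poly (map_poly complex_of_real (pderiv p)) z = 0" for z
    proof (rule ccontr)
      assume nonreal: "z \<notin> \<real>"
      have "map_poly complex_of_real (pderiv p) = smult (complex_of_real c) (pderiv ?P)"
        unfolding p by (simp add: pderiv_smult of_real_hom.map_poly_hom_smult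
            of_real_hom.map_poly_pderiv complex_of_real_split_poly)
      then have "poly (pderiv ?P) z = 0" using z \<open>c \<noteq> 0\<close> by simp
      moreover have "poly ?P z \<noteq> 0"
        using nonreal by (induction as) auto
      ultimately have "(\<Sum>a\<leftarrow>as. 1 / (z - complex_of_real a)) = 0"
        using pderiv_split_eq_sum_reciprocals[OF nonreal, of as] by simp
      then have "(\<Sum>a\<leftarrow>as. Im (1 / (z - complex_of_real a))) = 0"
        by (metis Im_sum_list zero_complex.sel(2))
      moreover have "Im (1 / (z - complex_of_real a)) = - Im z * (1 / (cmod (z - complex_of_real a))\<^sup>2)" for a
        by (simp add: Im_divide cmod_power2)
      ultimately have "- Im z * (\<Sum>a\<leftarrow>as. 1 / (cmod (z - complex_of_real a))\<^sup>2) = 0"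
        by (simp only: sum_list_const_mult)
      moreover have "(\<Sum>a\<leftarrow>as. 1 / (cmod (z - complex_of_real a))\<^sup>2) > 0"
      proof -
        have *: "1 / (cmod (z - complex_of_real a))\<^sup>2 > 0" for a
          using nonreal by auto
        show ?thesis using \<open>as \<noteq> []\<close>
        proof (induction as rule: list_nonempty_induct)
          case (cons x xs)
          then show ?case using *[of x] by (simp add: add_pos_pos del: zero_less_divide_iff)
        qed (use * in simp)
      qed
      moreover have "Im z \<noteq> 0" using nonreal by (simp add: complex_is_Real_iff)
      ultimately show False by simp
    qed
    then show ?thesis
      using splits_if_roots_real[of "pderiv p"] unfolding real_split_def by blast
  qed
qed

text \<open>
  With \<open>L = c\<^sub>1\<^sup>2 - 2 c\<^sub>0 c\<^sub>2\<close>, multiplying a polynomial by \<open>x - a\<close> turns \<open>L\<close> into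
  \<open>c\<^sub>0\<^sup>2 + a\<^sup>2 L\<close>, which keeps it nonnegative.
\<close>

lemma laguerre_inequality_at_0:
  assumes "real_split p"
  shows "2 * (coeff p 0 * coeff p 2) \<le> (coeff p 1)\<^sup>2"
proof -
  obtain c as where p: "p = smult c (\<Prod>a\<leftarrow>as. [:- a, 1:])"
    using assms unfolding real_split_def by blast
  define L where "L q = (coeff q 1)\<^sup>2 - 2 * (coeff q 0 * coeff q 2)" for q :: "real poly"
  have step: "L ([:- a, 1:] * q) = (coeff q 0)\<^sup>2 + a\<^sup>2 * L q" for a q
    unfolding L_def
    by (simp add: coeff_pCons numeral_2_eq_2 power2_eq_square algebra_simps)
  have "L (\<Prod>a\<leftarrow>as. [:- a, 1:]) \<ge> 0"
    by (induction as) (simp_all add: L_def[of 1] step del: mult_pCons_left)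
  moreover have "L p = c\<^sup>2 * L (\<Prod>a\<leftarrow>as. [:- a, 1:])"
    unfolding p L_def by (simp add: power2_eq_square algebra_simps)
  ultimately have "L p \<ge> 0" by simp
  then show ?thesis unfolding L_def by simp
qed

text \<open>
  The inequality at index \<open>k\<close> for \<open>p\<close> is the one at index \<open>0\<close> for the \<open>k\<close>-th derivative of \<open>p\<close>, up to
  positive factors.
\<close>

lemma newton_inequality:
  assumes "real_split p"
  shows "real (k + 2) * (coeff p k * coeff p (k + 2)) \<le> real (k + 1) * (coeff p (k + 1))\<^sup>2"
  using assms
proof (induction k arbitrary: p)
  case 0
  then show ?case using laguerre_inequality_at_0[of p] by (simp add: numeral_2_eq_2)
next
  case (Suc k)
  have "real (k + 2) * (coeff (pderiv p) k * coeff (pderiv p) (k + 2))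
      \<le> real (k + 1) * (coeff (pderiv p) (k + 1))\<^sup>2"
    using Suc.IH[OF real_split_pderiv[OF Suc.prems]] .
  then have "real ((k + 1) * (k + 2)) * (real (k + 3) * (coeff p (k + 1) * coeff p (k + 3)))
      \<le> real ((k + 1) * (k + 2)) * (real (k + 2) * (coeff p (k + 2))\<^sup>2)"
    by (simp add: coeff_pderiv power2_eq_square algebra_simps numeral_3_eq_3)
  then have "real (k + 3) * (coeff p (k + 1) * coeff p (k + 3)) \<le> real (k + 2) * (coeff p (k + 2))\<^sup>2"
    by (subst (asm) mult_le_cancel_left_pos) (simp_all only: of_nat_0_less_iff, simp)
  then show ?case by (simp add: numeral_3_eq_3 eval_nat_numeral)
qed

lemma log_concave_coeffs:
  assumes "real_split p"
  shows "coeff p k * coeff p (k + 2) \<le> (coeff p (k + 1))\<^sup>2"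
proof (cases "coeff p k * coeff p (k + 2) \<le> 0")
  case False
  have "real (k + 1) * (coeff p k * coeff p (k + 2)) \<le> real (k + 2) * (coeff p k * coeff p (k + 2))"
    using False by (intro mult_right_mono) auto
  also have "\<dots> \<le> real (k + 1) * (coeff p (k + 1))\<^sup>2"
    using newton_inequality[OF assms] .
  finally show ?thesis by (subst (asm) mult_le_cancel_left_pos) auto
qed (meson order_trans zero_le_power2)

text \<open>
  Log-concavity says that ratios of neighbouring entries decrease, as long as they are defined. The
  condition on the support excludes zeros between positive entries, across which log-concavity
  gives no information.
\<close>

lemma unimodal_if_log_concave:
  fixes a :: "nat \<Rightarrow> real"
  assumes nonneg: "\<And>k. k \<le> N \<Longrightarrow> 0 \<le> a k"
    and support: "\<And>k. k < N \<Longrightarrow> 0 < a k \<Longrightarrow> 0 < a (k + 1)"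
    and log_concave: "\<And>k. k + 2 \<le> N \<Longrightarrow> a k * a (k + 2) \<le> (a (k + 1))\<^sup>2"
  shows "unimodal N a"
proof -
  obtain m where "m \<le> N" and max: "\<And>i. i \<le> N \<Longrightarrow> a i \<le> a m"
  proof -
    have "Max (a ` {..N}) \<in> a ` {..N}" by (intro Max_in) auto
    then obtain m where m: "m \<le> N" "a m = Max (a ` {..N})" by force
    then show thesis by (intro that[of m]) auto
  qed
  \<comment> \<open>Both monotonicity statements propagate away from the maximum at \<open>m\<close>.\<close>
  have up: "a i \<le> a (i + 1)" if "i < m" for i
  proof -
    have "i \<le> m - 1" "m - 1 < m" using that by auto
    then show ?thesis
    proof (induction i rule: inc_induct)
      case base
      then show ?case using max[of "m - 1"] \<open>m \<le> N\<close> by auto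
    next
      case (step i)
      then have i: "i + 2 \<le> N" using \<open>m \<le> N\<close> by linarith
      have IH: "a (i + 1) \<le> a (i + 2)" using step by simp
      show ?case
      proof (cases "a (i + 2) = 0")
        case True
        then have "a (i + 1) = 0" using IH nonneg[of "i + 1"] i by simp
        then show ?thesis using support[of i] nonneg[of i] i by fastforce
      next
        case False
        then have pos: "a (i + 2) > 0" using nonneg[OF i] by simp
        have "a i * a (i + 2) \<le> a (i + 1) * a (i + 1)"
          using log_concave[OF i] by (simp add: power2_eq_square)
        also have "\<dots> \<le> a (i + 1) * a (i + 2)"
          using IH nonneg[of "i + 1"] i by (intro mult_left_mono) auto
        finally show ?thesis using pos by simp
      qed
    qed
  qed
  have positive_after: "0 < a i" if "0 < a m" "m \<le> i" "i \<le> N" for i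
    using that(2,3,1)
    by (induction i rule: dec_induct) (use support in auto)
  have down: "a (i + 1) \<le> a i" if "m \<le> i" "i < N" for i
    using that
  proof (induction i rule: dec_induct)
    case base
    then show ?case using max[of "m + 1"] by simp
  next
    case (step i)
    have IH: "a (i + 1) \<le> a i" using step by simp
    show ?case
    proof (cases "a m = 0")
      case True
      then show ?thesis using max[of "Suc i + 1"] nonneg[of "Suc i"] step by simp
    next
      case False
      then have "a m > 0" using nonneg[OF \<open>m \<le> N\<close>] by simp
      then have pos: "a i > 0" using positive_after[of i] step by simp
      have "a i * a (i + 2) \<le> a (i + 1) * a (i + 1)"
        using log_concave[of i] step by (simp add: power2_eq_square)
      also have "\<dots> \<le> a i * a (i + 1)"
        using IH nonneg[of "i + 1"] step by (intro mult_right_mono) auto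
      finally show ?thesis using pos by simp
    qed
  qed
  show ?thesis
    unfolding unimodal_def
  proof (intro exI[of _ m] conjI allI impI)
    fix i assume "1 \<le> i \<and> i \<le> m"
    then show "a (i - 1) \<le> a i" using up[of "i - 1"] by fastforce
  qed (use \<open>m \<le> N\<close> down in auto)
qed

section \<open>Symmetric matrices that are negative on the hyperplane of sum zero\<close>

lemma symmetric_eigenvalue_real:
  fixes A :: "real mat"
  assumes A: "A \<in> carrier_mat n n"
    and sym: "\<And>i j. i < n \<Longrightarrow> j < n \<Longrightarrow> A $$ (i, j) = A $$ (j, i)"
    and root: "poly (map_poly complex_of_real (char_poly A)) z = 0"
  shows "z \<in> \<real>"
proof -
  let ?C = "map_mat complex_of_real A"
  have C: "?C \<in> carrier_mat n n" using A by simp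
  have "poly (char_poly ?C) z = 0"
    using root of_real_hom.char_poly_hom[OF A] by metis
  then have "eigenvalue ?C z" using eigenvalue_root_char_poly[OF C] by simp
  then obtain v where v: "v \<in> carrier_vec n" "v \<noteq> 0\<^sub>v n" "?C *\<^sub>v v = z \<cdot>\<^sub>v v"
    using C unfolding eigenvalue_def eigenvector_def by auto
  have Cv: "(\<Sum>j<n. complex_of_real (A $$ (i, j)) * v $ j) = z * v $ i" if "i < n" for i
  proof -
    have "(?C *\<^sub>v v) $ i = (\<Sum>j<n. complex_of_real (A $$ (i, j)) * v $ j)"
      using that v(1) A by (auto simp: scalar_prod_def lessThan_atLeast0 intro!: sum.cong)
    then show ?thesis using v that by simp
  qed
  \<comment> \<open>\<open>S\<close> is the Hermitian form at the eigenvector: it is real by symmetry, and \<open>z\<close> times the squared norm.\<close>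
  define S where "S = (\<Sum>i<n. \<Sum>j<n. cnj (v $ i) * complex_of_real (A $$ (i, j)) * v $ j)"
  define N where "N = (\<Sum>i<n. (cmod (v $ i))\<^sup>2)"
  have "S = (\<Sum>i<n. cnj (v $ i) * (z * v $ i))"
    unfolding S_def by (intro sum.cong refl) (simp add: Cv[symmetric] sum_distrib_left mult.assoc)
  also have "\<dots> = z * complex_of_real N"
    unfolding N_def of_real_sum sum_distrib_left
    by (intro sum.cong refl) (metis complex_norm_square mult.assoc mult.commute)
  finally have S: "S = z * complex_of_real N" .
  have "cnj S = (\<Sum>i<n. \<Sum>j<n. v $ i * complex_of_real (A $$ (i, j)) * cnj (v $ j))"
    unfolding S_def by simp
  also have "\<dots> = (\<Sum>j<n. \<Sum>i<n. v $ i * complex_of_real (A $$ (i, j)) * cnj (v $ j))"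
    by (rule sum.swap)
  also have "\<dots> = S"
    unfolding S_def
  proof (intro sum.cong refl)
    fix i j assume "i \<in> {..<n}" "j \<in> {..<n}"
    then have "A $$ (i, j) = A $$ (j, i)" using sym by simp
    then show "v $ j * complex_of_real (A $$ (j, i)) * cnj (v $ i)
        = cnj (v $ i) * complex_of_real (A $$ (i, j)) * v $ j" by simp
  qed
  finally have "cnj S = S" .
  then have "Im S = 0" by (simp add: complex_eq_iff)
  then have "Im z * N = 0" unfolding S by simp
  moreover have "N \<noteq> 0"
  proof
    assume "N = 0"
    then have "v $ i = 0" if "i < n" for i
      using that unfolding N_def by (subst (asm) sum_nonneg_eq_0_iff) auto
    then show False using v(1,2) by (auto simp: vec_eq_iff)
  qed
  ultimately show ?thesis by (simp add: complex_is_Real_iff)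
qed

lemma symmetric_char_poly_splits:
  fixes A :: "real mat"
  assumes A: "A \<in> carrier_mat n n"
    and sym: "\<And>i j. i < n \<Longrightarrow> j < n \<Longrightarrow> A $$ (i, j) = A $$ (j, i)"
  obtains es where "char_poly A = (\<Prod>e\<leftarrow>es. [:- e, 1:])" "length es = n"
proof -
  have monic: "lead_coeff (char_poly A) = 1" and deg: "degree (char_poly A) = n"
    using degree_monic_char_poly[OF A] by auto
  obtain es where es: "char_poly A = (\<Prod>e\<leftarrow>es. [:- e, 1:])"
    using splits_if_roots_real[of "char_poly A"] symmetric_eigenvalue_real[OF A sym] monic by auto
  have "degree (\<Prod>e\<leftarrow>es. [:- e, 1:]) = length es"
    by (rule degree_linear_factors)
  then show thesis using that es deg by simp
qed

text \<open>
  Similar matrices have the same trace, applied to the Schur form, whose diagonal is \<open>es\<close>.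
\<close>

lemma sum_list_eigenvalues_eq_trace:
  fixes A :: "real mat"
  assumes A: "A \<in> carrier_mat n n" and es: "char_poly A = (\<Prod>e\<leftarrow>es. [:- e, 1:])"
  shows "sum_list es = (\<Sum>i<n. A $$ (i, i))"
proof -
  obtain B P Q where "schur_decomposition A es = (B, P, Q)" by (cases "schur_decomposition A es")
  from schur_decomposition[OF A es this]
  have wit: "similar_mat_wit A B P Q" and diag: "diag_mat B = es" by auto
  note w = similar_mat_witD2[OF A wit]
  have "A $$ (i, i) = (\<Sum>j<n. \<Sum>k<n. B $$ (j, k) * (Q $$ (k, i) * P $$ (i, j)))" if "i < n" for i
  proof -
    have "A $$ (i, i) = (\<Sum>j<n. P $$ (i, j) * (\<Sum>k<n. B $$ (j, k) * Q $$ (k, i)))"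
      using that w(4-7) by (subst w(3)) (auto simp: scalar_prod_def lessThan_atLeast0 intro!: sum.cong)
    then show ?thesis by (simp add: sum_distrib_left mult_ac)
  qed
  then have "(\<Sum>i<n. A $$ (i, i)) = (\<Sum>i<n. \<Sum>j<n. \<Sum>k<n. B $$ (j, k) * (Q $$ (k, i) * P $$ (i, j)))"
    by simp
  also have "\<dots> = (\<Sum>j<n. \<Sum>k<n. B $$ (j, k) * (\<Sum>i<n. Q $$ (k, i) * P $$ (i, j)))"
    by (subst sum.swap, rule sum.cong[OF refl], subst sum.swap) (simp add: sum_distrib_left)
  also have "\<dots> = (\<Sum>j<n. \<Sum>k<n. B $$ (j, k) * (if k = j then 1 else 0))"
  proof (intro sum.cong refl arg_cong2[of _ _ _ _ "(*)"])
    fix j k assume "j \<in> {..<n}" "k \<in> {..<n}"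
    then have "(Q * P) $$ (k, j) = (\<Sum>i<n. Q $$ (k, i) * P $$ (i, j))"
      using w(6,7) by (auto simp: scalar_prod_def lessThan_atLeast0 intro!: sum.cong)
    then show "(\<Sum>i<n. Q $$ (k, i) * P $$ (i, j)) = (if k = j then 1 else 0)"
      using \<open>j \<in> {..<n}\<close> \<open>k \<in> {..<n}\<close> w(2) by simp
  qed
  also have "\<dots> = (\<Sum>j<n. B $$ (j, j))"
    by (simp add: if_distrib cong: if_cong)
  also have "\<dots> = sum_list (diag_mat B)"
    using w(5) by (simp add: diag_mat_def sum_list_distinct_conv_sum_set lessThan_atLeast0 interv_sum_list_conv_sum_set_nat)
  finally show ?thesis using diag by simp
qed

text \<open>
  Here \<open>p\<close> and \<open>q\<close> are the first two columns of a change of basis to triangular form, which is why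
  \<open>q\<close> is an eigenvector only modulo \<open>p\<close>. By symmetry the component \<open>r\<close> of \<open>q\<close> orthogonal to \<open>p\<close> is
  a true eigenvector. If neither \<open>p\<close> nor \<open>r\<close> were zero, the form would be positive definite on
  their span, but this plane contains a nonzero vector of sum zero.
\<close>

lemma positive_eigenpair_dependent:
  fixes a :: "nat \<Rightarrow> nat \<Rightarrow> real" and p q :: "nat \<Rightarrow> real"
  assumes sym: "\<And>i j. i < n \<Longrightarrow> j < n \<Longrightarrow> a i j = a j i"
    and cnd: "\<And>x. (\<Sum>i<n. x i) = 0 \<Longrightarrow> (\<Sum>i<n. \<Sum>j<n. x i * x j * a i j) \<le> 0"
    and p: "\<And>i. i < n \<Longrightarrow> (\<Sum>j<n. a i j * p j) = e1 * p i"
    and q: "\<And>i. i < n \<Longrightarrow> (\<Sum>j<n. a i j * q j) = b * p i + e2 * q i"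
    and pos: "e1 > 0" "e2 > 0"
  shows "\<exists>s t. (s, t) \<noteq> (0, 0) \<and> (\<forall>i<n. s * p i + t * q i = 0)"
proof (rule ccontr)
  assume independent: "\<not> ?thesis"
  define N where "N = (\<Sum>i<n. p i * p i)"
  have N_pos: "N > 0"
  proof (rule ccontr)
    assume "\<not> N > 0"
    then have "N = 0" unfolding N_def using sum_nonneg[of "{..<n}" "\<lambda>i. p i * p i"] by fastforce
    then have "\<forall>i<n. p i = 0" unfolding N_def by (subst (asm) sum_nonneg_eq_0_iff) auto
    then have "\<forall>i<n. 1 * p i + 0 * q i = 0" by simp
    then show False using independent by (metis prod.inject zero_neq_one)
  qed
  \<comment> \<open>One Gram-Schmidt step.\<close>
  define c where "c = (\<Sum>i<n. p i * q i) / N"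
  define r where "r i = q i - c * p i" for i
  define d where "d = b + c * e2 - c * e1"
  have "(\<Sum>i<n. p i * r i) = (\<Sum>i<n. p i * q i) - c * N"
    unfolding r_def N_def by (simp add: algebra_simps sum_subtractf sum_distrib_left)
  then have orth: "(\<Sum>i<n. p i * r i) = 0"
    using N_pos unfolding c_def by simp
  have Ar: "(\<Sum>j<n. a i j * r j) = d * p i + e2 * r i" if "i < n" for i
  proof -
    have "(\<Sum>j<n. a i j * r j) = (\<Sum>j<n. a i j * q j) - c * (\<Sum>j<n. a i j * p j)"
      unfolding r_def by (simp add: algebra_simps sum_subtractf sum_distrib_left)
    then show ?thesis using p[OF that] q[OF that] unfolding r_def d_def by (simp add: algebra_simps)
  qed
  \<comment> \<open>Moving the matrix from \<open>r\<close> to \<open>p\<close> shows that the image of \<open>r\<close> is orthogonal to \<open>p\<close> too, so \<open>d\<close> vanishes.\<close>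
  have "(\<Sum>i<n. p i * (\<Sum>j<n. a i j * r j)) = (\<Sum>i<n. \<Sum>j<n. p i * a i j * r j)"
    by (simp add: sum_distrib_left mult_ac)
  also have "\<dots> = (\<Sum>j<n. \<Sum>i<n. p i * a i j * r j)" by (rule sum.swap)
  also have "\<dots> = (\<Sum>j<n. r j * (\<Sum>i<n. a j i * p i))"
    by (intro sum.cong refl) (simp add: sum_distrib_left sym mult_ac)
  also have "\<dots> = e1 * (\<Sum>j<n. p j * r j)" using p by (simp add: sum_distrib_left mult_ac)
  finally have "(\<Sum>i<n. p i * (\<Sum>j<n. a i j * r j)) = 0" using orth by simp
  moreover have "(\<Sum>i<n. p i * (\<Sum>j<n. a i j * r j)) = (\<Sum>i<n. d * (p i * p i) + e2 * (p i * r i))"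
    by (intro sum.cong refl, subst Ar) (simp_all add: algebra_simps)
  moreover have "\<dots> = d * N + e2 * (\<Sum>i<n. p i * r i)"
    unfolding N_def by (simp add: sum.distrib sum_distrib_left)
  ultimately have "d = 0" using orth N_pos by simp
  define M where "M = (\<Sum>i<n. r i * r i)"
  have M_pos: "M > 0"
  proof (rule ccontr)
    assume "\<not> M > 0"
    then have "M = 0" unfolding M_def using sum_nonneg[of "{..<n}" "\<lambda>i. r i * r i"] by fastforce
    then have "\<forall>i<n. r i = 0" unfolding M_def by (subst (asm) sum_nonneg_eq_0_iff) auto
    then have "\<forall>i<n. (- c) * p i + 1 * q i = 0" unfolding r_def by simp
    then show False using independent by (metis prod.inject zero_neq_one)
  qed
  obtain s t where st: "(s, t) \<noteq> (0, 0)" "s * (\<Sum>i<n. p i) + t * (\<Sum>i<n. r i) = 0"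
  proof (cases "(\<Sum>i<n. p i) = 0")
    case True
    then show ?thesis by (intro that[of 1 0]) auto
  next
    case False
    then show ?thesis by (intro that[of "(\<Sum>i<n. r i)" "- (\<Sum>i<n. p i)"]) auto
  qed
  define x where "x i = s * p i + t * r i" for i
  have "(\<Sum>i<n. x i) = 0"
    unfolding x_def using st(2) by (simp add: sum.distrib sum_distrib_left)
  then have "(\<Sum>i<n. \<Sum>j<n. x i * x j * a i j) \<le> 0" by (rule cnd)
  moreover have "(\<Sum>i<n. \<Sum>j<n. x i * x j * a i j) = s\<^sup>2 * e1 * N + t\<^sup>2 * e2 * M"
  proof -
    have Ax: "(\<Sum>j<n. a i j * x j) = s * e1 * p i + t * e2 * r i" if "i < n" for i
    proof -
      have "(\<Sum>j<n. a i j * x j) = s * (\<Sum>j<n. a i j * p j) + t * (\<Sum>j<n. a i j * r j)"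
        unfolding x_def by (simp add: algebra_simps sum.distrib sum_distrib_left)
      then show ?thesis using p[OF that] Ar[OF that] \<open>d = 0\<close> by simp
    qed
    have "(\<Sum>i<n. \<Sum>j<n. x i * x j * a i j) = (\<Sum>i<n. x i * (\<Sum>j<n. a i j * x j))"
      by (simp add: sum_distrib_left mult_ac)
    also have "\<dots> = (\<Sum>i<n. s\<^sup>2 * e1 * (p i * p i) + t\<^sup>2 * e2 * (r i * r i) + s * t * (e1 + e2) * (p i * r i))"
      by (intro sum.cong refl, subst Ax) (simp_all add: x_def power2_eq_square algebra_simps)
    also have "\<dots> = s\<^sup>2 * e1 * N + t\<^sup>2 * e2 * M + s * t * (e1 + e2) * (\<Sum>i<n. p i * r i)"
      unfolding N_def M_def by (simp add: sum.distrib sum_distrib_left)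
    finally show ?thesis using orth by simp
  qed
  moreover have "s\<^sup>2 * e1 * N + t\<^sup>2 * e2 * M > 0"
  proof (cases "s = 0")
    case True
    then show ?thesis using st(1) pos M_pos by simp
  next
    case False
    then show ?thesis using pos N_pos M_pos by (intro add_pos_nonneg) auto
  qed
  ultimately show False by simp
qed

text \<open>
  As the Schur decomposition accepts the eigenvalues in any order, any two of them, counted with
  multiplicity, can be brought to the front; the corresponding first two columns of the invertible
  matrix \<open>P\<close> are independent. This covers multiple eigenvalues without an orthonormal eigenbasis.
\<close>

lemma not_two_positive_eigenvalues:
  fixes A :: "real mat"
  assumes A: "A \<in> carrier_mat n n"
    and sym: "\<And>i j. i < n \<Longrightarrow> j < n \<Longrightarrow> A $$ (i, j) = A $$ (j, i)"
    and cnd: "\<And>x. (\<Sum>i<n. x i) = 0 \<Longrightarrow> (\<Sum>i<n. \<Sum>j<n. x i * x j * A $$ (i, j)) \<le> 0"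
    and es: "char_poly A = (\<Prod>e\<leftarrow>e1 # e2 # es. [:- e, 1:])"
  shows "e1 \<le> 0 \<or> e2 \<le> 0"
proof (rule ccontr)
  assume neg: "\<not> ?thesis"
  obtain B P Q where "schur_decomposition A (e1 # e2 # es) = (B, P, Q)"
    by (cases "schur_decomposition A (e1 # e2 # es)")
  from schur_decomposition[OF A es this]
  have wit: "similar_mat_wit A B P Q" and ut: "upper_triangular B"
    and diag: "diag_mat B = e1 # e2 # es" by auto
  note w = similar_mat_witD2[OF A wit]
  have n: "n = length (e1 # e2 # es)"
    using arg_cong[OF diag, of length] w(5) by (simp add: diag_mat_def)
  have B_diag: "B $$ (0, 0) = e1" "B $$ (1, 1) = e2"
  proof -
    have "B $$ (i, i) = (e1 # e2 # es) ! i" if "i < n" for i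
      using that w(5) unfolding diag[symmetric] diag_mat_def by simp
    then show "B $$ (0, 0) = e1" "B $$ (1, 1) = e2" using n by auto
  qed
  have "A * P = P * B * Q * P" using w(3) by simp
  also have "\<dots> = P * B * (Q * P)" using w(4-7) by (meson assoc_mult_mat mult_carrier_mat)
  also have "\<dots> = P * B" using w(2,5,6) by simp
  finally have AP: "A * P = P * B" .
  have AP_entry: "(\<Sum>k<n. A $$ (i, k) * P $$ (k, j)) = (\<Sum>k<n. P $$ (i, k) * B $$ (k, j))"
    if "i < n" "j < n" for i j
  proof -
    have "(A * P) $$ (i, j) = (\<Sum>k<n. A $$ (i, k) * P $$ (k, j))"
      using that A w(6) by (auto simp: scalar_prod_def lessThan_atLeast0 intro!: sum.cong)
    moreover have "(P * B) $$ (i, j) = (\<Sum>k<n. P $$ (i, k) * B $$ (k, j))"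
      using that w(5,6) by (auto simp: scalar_prod_def lessThan_atLeast0 intro!: sum.cong)
    ultimately show ?thesis using AP by simp
  qed
  have n2: "0 < n" "1 < n" using n by auto
  have lower: "B $$ (k, j) = 0" if "j < k" "k < n" for j k
    using ut that w(5) unfolding upper_triangular_def by auto
  have col0: "(\<Sum>k<n. A $$ (i, k) * P $$ (k, 0)) = e1 * P $$ (i, 0)" if "i < n" for i
  proof -
    have "(\<Sum>k<n. P $$ (i, k) * B $$ (k, 0)) = (\<Sum>k\<in>{0}. P $$ (i, k) * B $$ (k, 0))"
      using n2 lower by (intro sum.mono_neutral_right) auto
    then show ?thesis using AP_entry[OF that n2(1)] B_diag by simp
  qed
  have col1: "(\<Sum>k<n. A $$ (i, k) * P $$ (k, 1)) = B $$ (0, 1) * P $$ (i, 0) + e2 * P $$ (i, 1)"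
    if "i < n" for i
  proof -
    have "(\<Sum>k<n. P $$ (i, k) * B $$ (k, 1)) = (\<Sum>k\<in>{0, 1}. P $$ (i, k) * B $$ (k, 1))"
      using n2 lower[of 1] by (intro sum.mono_neutral_right) auto
    then show ?thesis using AP_entry[OF that n2(2)] B_diag by simp
  qed
  obtain s t where st: "(s, t) \<noteq> (0, 0)" "\<forall>i<n. s * P $$ (i, 0) + t * P $$ (i, 1) = 0"
    using positive_eigenpair_dependent[of n "\<lambda>i j. A $$ (i, j)" "\<lambda>i. P $$ (i, 0)" e1 "\<lambda>i. P $$ (i, 1)",
        OF sym cnd col0 col1] neg by auto
  have QP: "(\<Sum>i<n. Q $$ (k, i) * P $$ (i, j)) = (if k = j then 1 else 0)" if "k < n" "j < n" for k j
  proof -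
    have "(Q * P) $$ (k, j) = (\<Sum>i<n. Q $$ (k, i) * P $$ (i, j))"
      using that w(6,7) by (auto simp: scalar_prod_def lessThan_atLeast0 intro!: sum.cong)
    then show ?thesis using that w(2) by simp
  qed
  have "s * (\<Sum>i<n. Q $$ (k, i) * P $$ (i, 0)) + t * (\<Sum>i<n. Q $$ (k, i) * P $$ (i, 1)) = 0" for k
  proof -
    have "s * (\<Sum>i<n. Q $$ (k, i) * P $$ (i, 0)) + t * (\<Sum>i<n. Q $$ (k, i) * P $$ (i, 1))
        = (\<Sum>i<n. Q $$ (k, i) * (s * P $$ (i, 0) + t * P $$ (i, 1)))"
      by (simp add: sum_distrib_left sum.distrib algebra_simps)
    then show ?thesis using st(2) by simp
  qed
  from this[of 0] this[of 1] show False using QP n2 st(1) by simp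
qed

lemma linear_factors_coeff_nonneg:
  fixes ms :: "real list"
  assumes "\<forall>m\<in>set ms. 0 \<le> m"
  shows "0 \<le> coeff (\<Prod>m\<leftarrow>ms. [:m, 1:]) k"
  using assms by (induction ms arbitrary: k) (auto simp: coeff_pCons split: nat.splits)

text \<open>
  In terms of elementary symmetric functions \<open>e\<^sub>j\<close> of \<open>ms\<close>, this is \<open>(j + 1) e\<^sub>j\<^sub>+\<^sub>1 \<le> e\<^sub>1 e\<^sub>j\<close> for
  \<open>j = length ms - k - 1\<close>: expanding the right-hand side produces every squarefree monomial of
  degree \<open>j + 1\<close> exactly \<open>j + 1\<close> times, besides other nonnegative terms. For
  \<open>k \<ge> length ms\<close> the left-hand side is 0.
\<close>

lemma linear_factors_coeff_ratio:
  fixes ms :: "real list"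
  assumes "\<forall>m\<in>set ms. 0 \<le> m"
  shows "(real (length ms) - real k) * coeff (\<Prod>m\<leftarrow>ms. [:m, 1:]) k
    \<le> sum_list ms * coeff (\<Prod>m\<leftarrow>ms. [:m, 1:]) (k + 1)"
  using assms
proof (induction ms arbitrary: k)
  case Nil
  then show ?case by simp
next
  case (Cons t ms)
  define q where "q = coeff (\<Prod>m\<leftarrow>ms. [:m, 1:])"
  define s where "s = sum_list ms"
  define N where "N = real (length ms)"
  have t: "0 \<le> t" and ms: "\<forall>m\<in>set ms. 0 \<le> m" using Cons.prems by auto
  have q: "0 \<le> q k" for k unfolding q_def using linear_factors_coeff_nonneg[OF ms] .
  have IH: "(N - real k) * q k \<le> s * q (k + 1)" for k
    unfolding N_def q_def s_def using Cons.IH[OF ms] .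
  \<comment> \<open>\<open>r\<close> is the coefficient of index \<open>k - 1\<close>, which is 0 for \<open>k = 0\<close>.\<close>
  have step: "(N + 1 - real k) * (t * q k + r) \<le> (t + s) * (t * q (k + 1) + q k)"
    if "(N + 1 - real k) * r \<le> s * q k" for r
  proof -
    have "t * ((N - real k) * q k) \<le> t * (s * q (k + 1))"
      using IH t by (rule mult_left_mono)
    moreover have "0 \<le> t * t * q (k + 1)" using q t by simp
    ultimately show ?thesis using that by (simp add: algebra_simps)
  qed
  show ?case
  proof (cases k)
    case 0
    have "0 \<le> s * q 0" using q ms unfolding s_def by (intro mult_nonneg_nonneg sum_list_nonneg) auto
    then show ?thesis using step[of 0] 0
      by (simp add: q_def s_def N_def algebra_simps)
  next
    case (Suc j)
    then show ?thesis using step[of "q j"] IH[of j]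
      by (simp add: q_def s_def N_def algebra_simps)
  qed
qed

lemma det_minus_x_eq_char_poly:
  assumes A: "A \<in> carrier_mat n n"
  shows "det_minus_x A = smult ((- 1) ^ n) (char_poly A)"
proof -
  have "map_mat (\<lambda>a. [:a:]) A - [:0, 1:] \<cdot>\<^sub>m 1\<^sub>m (dim_row A) = (- 1) \<cdot>\<^sub>m char_poly_matrix A"
    using A unfolding char_poly_matrix_def by (intro eq_matI) auto
  then have "det_minus_x A = (- 1) ^ dim_col (char_poly_matrix A) * char_poly A"
    unfolding det_minus_x_def char_poly_def by (simp add: det_smult)
  moreover have "dim_col (char_poly_matrix A) = n"
    using A by (metis carrier_matD(2) char_poly_matrix_closed)
  moreover have "(- 1) ^ n * p = smult ((- 1) ^ n) p" for p :: "real poly"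
    by (cases "even n") auto
  ultimately show ?thesis by simp
qed

text \<open>
  With the eigenvalues sorted decreasingly, all but the first are nonpositive, and the zero diagonal
  makes the first one the sum \<open>l\<close> of their absolute values. For \<open>k \<ge> 1\<close> the entry of index \<open>k\<close> is
  \<open>l q\<^sub>k - q\<^sub>k\<^sub>-\<^sub>1\<close>, which the comparison of neighbouring coefficients bounds below by
  \<open>(n - 1 - k) q\<^sub>k\<^sub>-\<^sub>1\<close>. The factor is positive exactly for \<open>k \<le> n - 2\<close>.
\<close>

lemma unimodal_if_conditionally_negative:
  fixes A :: "real mat"
  assumes A: "A \<in> carrier_mat n n" and n: "n \<ge> 2"
    and sym: "\<And>i j. i < n \<Longrightarrow> j < n \<Longrightarrow> A $$ (i, j) = A $$ (j, i)"
    and diag: "\<And>i. i < n \<Longrightarrow> A $$ (i, i) = 0"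
    and cnd: "\<And>x. (\<Sum>i<n. x i) = 0 \<Longrightarrow> (\<Sum>i<n. \<Sum>j<n. x i * x j * A $$ (i, j)) \<le> 0"
  shows "unimodal (n - 2) (\<lambda>k. (- 1) ^ (n - 1) * coeff (det_minus_x A) k)"
proof -
  obtain es0 where es0: "char_poly A = (\<Prod>e\<leftarrow>es0. [:- e, 1:])" "length es0 = n"
    using symmetric_char_poly_splits[OF A sym] by blast
  obtain l es where es: "char_poly A = (\<Prod>e\<leftarrow>l # es. [:- e, 1:])" "length (l # es) = n"
    and nonpos: "\<forall>e\<in>set es. e \<le> 0"
  proof -
    define es1 where "es1 = rev (sort es0)"
    have es1: "char_poly A = (\<Prod>e\<leftarrow>es1. [:- e, 1:])" "length es1 = n"
    proof -
      have "(\<Prod>e\<leftarrow>es1. [:- e, 1:]) = (\<Prod>e\<leftarrow>es0. [:- e, 1:])"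
        by (simp only: prod_mset_prod_list[symmetric] mset_map) (simp add: es1_def)
      then show "char_poly A = (\<Prod>e\<leftarrow>es1. [:- e, 1:])" "length es1 = n"
        using es0 by (simp_all add: es1_def)
    qed
    have sorted: "sorted_wrt (\<ge>) es1" unfolding es1_def by (simp add: sorted_wrt_rev)
    obtain l e2 es2 where ls: "es1 = l # e2 # es2"
      using es1(2) n by (cases es1; cases "tl es1") auto
    have "l \<le> 0 \<or> e2 \<le> 0"
      using not_two_positive_eigenvalues[OF A sym cnd, of l e2 es2] es1(1) ls by simp
    then have "\<forall>e\<in>set (e2 # es2). e \<le> 0" using sorted unfolding ls by force
    then show thesis using that[of l "e2 # es2"] es1 ls by simp
  qed
  define ms where "ms = map uminus es"
  define q where "q = coeff (\<Prod>m\<leftarrow>ms. [:m, 1:])"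
  have ms: "\<forall>m\<in>set ms. 0 \<le> m" "length ms = n - 1"
    using nonpos es(2) unfolding ms_def by auto
  have l: "l = sum_list ms"
  proof -
    have "sum_list (map uminus xs) = - sum_list xs" for xs :: "real list"
      by (induction xs) auto
    then show ?thesis
      using sum_list_eigenvalues_eq_trace[OF A es(1)] diag unfolding ms_def by simp
  qed
  have l_nonneg: "0 \<le> l" unfolding l using ms(1) by (intro sum_list_nonneg) auto
  have q_nonneg: "0 \<le> q k" for k
    unfolding q_def using linear_factors_coeff_nonneg[OF ms(1)] .
  have q_ratio: "(real (n - 1) - real k) * q k \<le> l * q (k + 1)" for k
    unfolding q_def l using linear_factors_coeff_ratio[OF ms(1)] ms(2) by simp
  define b where "b k = (- 1) ^ (n - 1) * coeff (det_minus_x A) k" for k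
  have b: "b k = - coeff (char_poly A) k" for k
  proof -
    have "(- 1 :: real) ^ (n - 1) * (- 1) ^ n = - 1"
      using n by (cases n) (auto simp flip: power_add mult_2)
    then show ?thesis unfolding b_def det_minus_x_eq_char_poly[OF A] by (simp flip: mult.assoc)
  qed
  have char_poly: "char_poly A = [:- l, 1:] * (\<Prod>m\<leftarrow>ms. [:m, 1:])"
    unfolding es(1) ms_def by (simp add: o_def del: mult_pCons_left)
  have b0: "b 0 = l * q 0" unfolding b char_poly q_def by simp
  have bSuc: "b (Suc k) = l * q (Suc k) - q k" for k
    unfolding b char_poly q_def by simp
  have b_lower: "(real (n - 2) - real k) * q k \<le> b (Suc k)" for k
    using q_ratio[of k] n unfolding bSuc by (simp add: algebra_simps of_nat_diff)
  have "unimodal (n - 2) b"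
  proof (rule unimodal_if_log_concave)
    fix k assume k: "k \<le> n - 2"
    show "0 \<le> b k"
    proof (cases k)
      case 0
      then show ?thesis using b0 l_nonneg q_nonneg by simp
    next
      case (Suc j)
      have "0 \<le> (real (n - 2) - real j) * q j" using q_nonneg k Suc by (intro mult_nonneg_nonneg) auto
      then show ?thesis using b_lower[of j] unfolding Suc by (rule order_trans)
    qed
  next
    fix k assume k: "k < n - 2" "0 < b k"
    \<comment> \<open>A positive entry forces \<open>q k > 0\<close>, and then the lower bound for the next entry is positive.\<close>
    have "b k \<le> l * q k" using b0 bSuc q_nonneg by (cases k) auto
    then have "q k > 0" using k(2) l_nonneg q_nonneg[of k] by (metis less_le_trans less_le mult_zero_right)
    then have "0 < (real (n - 2) - real k) * q k" using k(1) by simp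
    then show "0 < b (k + 1)" using b_lower[of k] by simp
  next
    fix k
    have "real_split (char_poly A)"
      unfolding real_split_def using es(1) by (metis smult_1_left)
    then show "b k * b (k + 2) \<le> (b (k + 1))\<^sup>2"
      using log_concave_coeffs unfolding b by simp
  qed
  then show ?thesis unfolding b_def .
qed

section \<open>Distances in graphs whose cycles span cliques\<close>

abbreviation symdiff :: "'a set \<Rightarrow> 'a set \<Rightarrow> 'a set" where
  "symdiff X Y \<equiv> (X - Y) \<union> (Y - X)"

lemma card_symdiff_triangle:
  assumes "finite X" "finite Y" "finite Z"
  shows "card (symdiff X Z) \<le> card (symdiff X Y) + card (symdiff Y Z)"
proof -
  have "card (symdiff X Z) \<le> card (symdiff X Y \<union> symdiff Y Z)"
    using assms by (intro card_mono) auto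
  also have "\<dots> \<le> card (symdiff X Y) + card (symdiff Y Z)" by (rule card_Un_le)
  finally show ?thesis .
qed

text \<open>
  The kernel is the sum over all points \<open>z\<close> of the cut kernels that tell whether exactly one of the two
  sets contains \<open>z\<close>. On vectors of sum zero the mixed terms of a cut cancel and minus twice a square
  remains.
\<close>

lemma symdiff_kernel_conditionally_negative:
  fixes F :: "nat \<Rightarrow> 'b set" and x :: "nat \<Rightarrow> real"
  assumes fin: "\<And>i. i < n \<Longrightarrow> finite (F i)" and zero: "(\<Sum>i<n. x i) = 0"
  shows "(\<Sum>i<n. \<Sum>j<n. x i * x j * real (card (symdiff (F i) (F j)))) \<le> 0"
proof -
  define Z where "Z = (\<Union>i<n. F i)"
  define f where "f z i = (if z \<in> F i then 1 else 0 :: real)" for z i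
  have "finite Z" unfolding Z_def using fin by auto
  have card: "real (card (symdiff (F i) (F j))) = (\<Sum>z\<in>Z. f z i + f z j - 2 * f z i * f z j)"
    if "i < n" "j < n" for i j
  proof -
    have count: "real (card S) = (\<Sum>z\<in>Z. if z \<in> S then 1 else 0)" if "S \<subseteq> Z" for S
      using that \<open>finite Z\<close> by (simp add: sum.If_cases Int_absorb1)
    have "symdiff (F i) (F j) \<subseteq> Z" unfolding Z_def using that by auto
    then have "real (card (symdiff (F i) (F j))) = (\<Sum>z\<in>Z. if z \<in> symdiff (F i) (F j) then 1 else 0)"
      by (rule count)
    also have "\<dots> = (\<Sum>z\<in>Z. f z i + f z j - 2 * f z i * f z j)"
      by (intro sum.cong refl) (auto simp: f_def)
    finally show ?thesis .
  qed
  have cut: "(\<Sum>i<n. \<Sum>j<n. x i * x j * (f z i + f z j - 2 * f z i * f z j)) = - 2 * (\<Sum>i<n. x i * f z i)\<^sup>2" for z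
  proof -
    have "(\<Sum>i<n. \<Sum>j<n. x i * x j * (f z i + f z j - 2 * f z i * f z j))
        = (\<Sum>i<n. \<Sum>j<n. (x i * f z i) * x j) + (\<Sum>i<n. \<Sum>j<n. x i * (x j * f z j))
          - 2 * (\<Sum>i<n. \<Sum>j<n. (x i * f z i) * (x j * f z j))"
      by (simp add: sum_distrib_left algebra_simps sum.distrib sum_subtractf)
    also have "\<dots> = - 2 * ((\<Sum>i<n. x i * f z i) * (\<Sum>j<n. x j * f z j))"
      unfolding sum_product[symmetric] zero by simp
    finally show ?thesis by (simp add: power2_eq_square)
  qed
  have "(\<Sum>i<n. \<Sum>j<n. x i * x j * real (card (symdiff (F i) (F j))))
      = (\<Sum>i<n. \<Sum>j<n. \<Sum>z\<in>Z. x i * x j * (f z i + f z j - 2 * f z i * f z j))"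
    by (intro sum.cong refl) (simp add: card sum_distrib_left)
  also have "\<dots> = (\<Sum>i<n. \<Sum>z\<in>Z. \<Sum>j<n. x i * x j * (f z i + f z j - 2 * f z i * f z j))"
    by (intro sum.cong refl sum.swap)
  also have "\<dots> = (\<Sum>z\<in>Z. \<Sum>i<n. \<Sum>j<n. x i * x j * (f z i + f z j - 2 * f z i * f z j))"
    by (rule sum.swap)
  also have "\<dots> \<le> 0"
    unfolding cut by (intro sum_nonpos) simp
  finally show ?thesis .
qed

text \<open>
  The facts about a connected graph and its distance that the Hamming embedding needs. The axioms
  \<open>d_self\<close>, \<open>d_step\<close> and \<open>d_pred\<close> characterize the distance; the latter also expresses connectedness.
\<close>

locale clique_cycle_metric =
  fixes V :: "'a set" and adj :: "'a \<Rightarrow> 'a \<Rightarrow> bool" and d :: "'a \<Rightarrow> 'a \<Rightarrow> nat"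
  assumes adj_V: "adj u v \<Longrightarrow> u \<in> V \<and> v \<in> V"
    and adj_sym: "adj u v \<Longrightarrow> adj v u"
    and adj_irrefl: "\<not> adj u u"
    and d_self: "u \<in> V \<Longrightarrow> d u u = 0"
    and d_step: "u \<in> V \<Longrightarrow> adj x y \<Longrightarrow> d u y \<le> d u x + 1"
    and d_pred: "u \<in> V \<Longrightarrow> y \<in> V \<Longrightarrow> y \<noteq> u \<Longrightarrow> \<exists>x. adj x y \<and> d u y = d u x + 1"
    and cycle_clique: "distinct c \<Longrightarrow> length c \<ge> 3 \<Longrightarrow> successively adj c \<Longrightarrow> adj (last c) (hd c)
      \<Longrightarrow> x \<in> set c \<Longrightarrow> y \<in> set c \<Longrightarrow> x \<noteq> y \<Longrightarrow> adj x y"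
begin

lemma d_eq_0_iff: "u \<in> V \<Longrightarrow> v \<in> V \<Longrightarrow> d u v = 0 \<longleftrightarrow> u = v"
  using d_self d_pred by fastforce

lemma d_triangle:
  assumes "u \<in> V" "v \<in> V" "w \<in> V"
  shows "d u w \<le> d u v + d v w"
  using assms(3)
proof (induction "d v w" arbitrary: w)
  case 0
  then show ?case using d_eq_0_iff[OF assms(2)] by simp
next
  case (Suc k)
  then have "w \<noteq> v" using d_self assms(2) by auto
  then obtain x where x: "adj x w" "d v w = d v x + 1" using d_pred assms(2) Suc.prems by blast
  then have "d u x \<le> d u v + d v x" using Suc adj_V by auto
  then show ?case using d_step[OF assms(1) x(1)] x(2) by simp
qed

lemma d_adj: "adj u v \<Longrightarrow> d u v = 1"
  using d_step[of u u v] d_self[of u] d_eq_0_iff[of u v] adj_V[of u v] adj_irrefl[of u]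
  by (cases "u = v") auto

lemma d_commute_le:
  assumes "u \<in> V" "v \<in> V"
  shows "d v u \<le> d u v"
  using assms(2)
proof (induction "d u v" arbitrary: v)
  case 0
  then have "u = v" using d_eq_0_iff[OF assms(1), of v] by simp
  then show ?case by simp
next
  case (Suc k)
  then have "v \<noteq> u" using d_self assms(1) by auto
  then obtain x where x: "adj x v" "d u v = d u x + 1" using d_pred assms(1) Suc.prems by blast
  have "x \<in> V" using x(1) adj_V by blast
  then have "d x u \<le> d u x" using Suc x(2) by simp
  moreover have "d v u \<le> d v x + d x u" using d_triangle \<open>x \<in> V\<close> assms(1) Suc.prems by blast
  ultimately show ?case using d_adj[OF adj_sym[OF x(1)]] x(2) by simp
qed

lemma d_commute: "u \<in> V \<Longrightarrow> v \<in> V \<Longrightarrow> d u v = d v u"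
  using d_commute_le by (simp add: antisym)

text \<open>
  Vertices \<open>p\<close> and \<open>q\<close> of the same level cannot be joined by a path that stays above this level.
  Descending from \<open>p\<close> and \<open>q\<close> towards the root, the two descents meet eventually, which closes a
  cycle. Its lowest vertex would be adjacent to an inner vertex of the original path, which is at
  least two levels higher. The induction descends by one level and extends the path at both ends.
\<close>

lemma no_detour_above:
  assumes r: "r \<in> V"
    and "p \<noteq> q" "d r p = k" "d r q = k" "ins \<noteq> []"
    and "distinct (p # ins @ [q])" "successively adj (p # ins @ [q])"
    and "\<forall>x\<in>set ins. k < d r x"
  shows False
proof -
  have ends_in_V: "p \<in> V \<and> q \<in> V" if "successively adj (p # ins @ [q])" "ins \<noteq> []" for p q ins
  proof -
    have "adj p (hd ins)" "adj (last ins) q"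
      using that by (simp_all add: successively_append_iff successively_Cons)
    then show ?thesis using adj_V by blast
  qed
  show False
    using assms(2-)
  proof (induction k arbitrary: p q ins)
    case (0 p q ins)
    have "p \<in> V" "q \<in> V"
      using ends_in_V[OF "0.prems"(6,4)] by blast+
    then have "p = r" "q = r" using "0.prems"(2,3) d_eq_0_iff[OF r] by auto
    then show False using "0.prems"(1) by simp
  next
    case (Suc k p q ins)
    have V: "p \<in> V" "q \<in> V"
      using ends_in_V[OF Suc.prems(6,4)] by blast+
    have "p \<noteq> r" "q \<noteq> r" using Suc.prems d_self[OF r] by auto
    then obtain p' q' where p': "adj p' p" "d r p' = k" and q': "adj q' q" "d r q' = k"
      using d_pred[OF r V(1)] d_pred[OF r V(2)] Suc.prems by fastforce
    have high: "\<forall>x\<in>set (p # ins @ [q]). k < d r x" using Suc.prems by auto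
    then have new: "p' \<notin> set (p # ins @ [q])" "q' \<notin> set (p # ins @ [q])"
      using p'(2) q'(2) less_irrefl by metis+
    show False
    proof (cases "p' = q'")
      case True
      let ?c = "p' # p # ins @ [q]"
      obtain x where x: "x \<in> set ins" using \<open>ins \<noteq> []\<close> by (cases ins) auto
      have "adj p' x"
        using cycle_clique[of ?c p' x] Suc.prems(5,6) new p'(1) adj_sym[OF q'(1)] True x by auto
      then have "d r x \<le> k + 1" using d_step[OF r] p'(2) by metis
      then show False using Suc.prems x by force
    next
      case False
      have "successively adj ((p # ins @ [q]) @ [q'])"
        unfolding successively_append_iff using Suc.prems(6) adj_sym[OF q'(1)] by simp
      then have "successively adj (p' # (p # ins @ [q]) @ [q'])"
        using p'(1) by simp
      moreover have "distinct (p' # (p # ins @ [q]) @ [q'])"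
        using Suc.prems(5) new False by auto
      ultimately show False
        using Suc.IH[of p' q' "p # ins @ [q]"] False p'(2) q'(2) high by blast
    qed
  qed
qed

text \<open>
  The three structural properties of the levels follow: two lower neighbours of a vertex, or
  different lower neighbours of adjacent vertices, would be joined by a detour through the higher
  level; and a path of length 2 inside a level closes to a 4-cycle through the common lower
  neighbour.
\<close>

lemma lower_neighbour_unique:
  assumes "r \<in> V" "adj p v" "adj q v" "d r v = d r p + 1" "d r v = d r q + 1"
  shows "p = q"
proof (rule ccontr)
  assume "p \<noteq> q"
  moreover have "p \<noteq> v \<and> v \<noteq> q" using assms adj_irrefl by blast
  ultimately show False
    using no_detour_above[of r p q "d r p" "[v]"] assms adj_sym[OF assms(3)] by auto
qed

lemma level_neighbours_share_lower_neighbour: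
  assumes "r \<in> V" "adj u v" "d r u = d r v"
    and "adj p u" "adj q v" "d r u = d r p + 1" "d r v = d r q + 1"
  shows "p = q"
proof (rule ccontr)
  assume "p \<noteq> q"
  moreover have "u \<noteq> v" using assms(2) adj_irrefl by blast
  moreover have "p \<noteq> u \<and> p \<noteq> v \<and> u \<noteq> q \<and> v \<noteq> q" using assms(3,6,7) by auto
  ultimately show False
    using no_detour_above[of r p q "d r p" "[u, v]"] assms adj_sym[OF assms(5)] by auto
qed

lemma level_adjacency_transitive:
  assumes r: "r \<in> V" and "adj u v" "adj v w" "d r u = d r v" "d r v = d r w" "u \<noteq> w"
  shows "adj u w"
proof -
  have V: "u \<in> V" "v \<in> V" "w \<in> V" using assms adj_V by blast+
  have "u \<noteq> r"
  proof
    assume "u = r"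
    then have "d r v = 0" using assms(4) d_self[OF r] by simp
    then have "v = r" using d_eq_0_iff[OF r V(2)] by simp
    then show False using \<open>adj u v\<close> \<open>u = r\<close> adj_irrefl by simp
  qed
  moreover from this have "v \<noteq> r" "w \<noteq> r"
    using assms(4,5) d_self[OF r] d_eq_0_iff[OF r V(1)] by auto
  ultimately obtain p q s where p: "adj p u" "d r u = d r p + 1" and q: "adj q v" "d r v = d r q + 1"
    and s: "adj s w" "d r w = d r s + 1"
    using d_pred[OF r V(1)] d_pred[OF r V(2)] d_pred[OF r V(3)] by blast
  have "p = q"
    using level_neighbours_share_lower_neighbour[OF r assms(2,4) p(1) q(1) p(2) q(2)] .
  moreover have "q = s"
    using level_neighbours_share_lower_neighbour[OF r assms(3,5) q(1) s(1) q(2) s(2)] .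
  moreover have "u \<noteq> v" "v \<noteq> w" using assms adj_irrefl by blast+
  moreover have "p \<noteq> u \<and> p \<noteq> v \<and> p \<noteq> w" using p(2) assms(4,5) by auto
  ultimately show ?thesis
    using cycle_clique[of "[p, u, v, w]" u w] assms p adj_sym[OF s(1)] q s by auto
qed

end

locale rooted_clique_cycle_metric = clique_cycle_metric +
  fixes r :: 'a
  assumes root: "r \<in> V"
begin

definition parent :: "'a \<Rightarrow> 'a" where
  "parent v = (SOME p. adj p v \<and> d r v = d r p + 1)"

definition ancestors :: "'a \<Rightarrow> 'a set" where
  "ancestors v = (\<lambda>i. (parent ^^ i) v) ` {..<d r v}"

definition siblings :: "'a \<Rightarrow> 'a set" where
  "siblings v = {w. d r w = d r v \<and> (w = v \<or> adj w v)}"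

text \<open>
  The two kinds of features are the edges of the breadth-first tree, named by their upper ends, and
  the sibling cliques. Distinct siblings share their proper ancestors; adjacent ones share their
  clique as well, so their feature sets differ in 2 elements rather than 4.
\<close>

definition features :: "'a \<Rightarrow> ('a + 'a set) set" where
  "features v = Inl ` ancestors v \<union> Inr ` siblings ` ancestors v"

lemma parent:
  assumes "v \<in> V" "v \<noteq> r"
  shows "adj (parent v) v" "d r v = d r (parent v) + 1" "parent v \<in> V"
proof -
  show "adj (parent v) v" "d r v = d r (parent v) + 1"
    unfolding parent_def using someI_ex[OF d_pred[OF root assms]] by blast+
  then show "parent v \<in> V" using adj_V by blast
qed

lemma finite_features: "finite (features v)"
  unfolding features_def ancestors_def by simp

lemma features_root: "features r = {}"
  unfolding features_def ancestors_def using d_self[OF root] by simp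

lemma ancestors_step:
  assumes "v \<in> V" "v \<noteq> r"
  shows "ancestors v = insert v (ancestors (parent v))"
  unfolding ancestors_def parent(2)[OF assms]
  by (simp add: lessThan_Suc_eq_insert_0 image_image funpow_swap1)

lemma features_step:
  assumes "v \<in> V" "v \<noteq> r"
  shows "features v = insert (Inl v) (insert (Inr (siblings v)) (features (parent v)))"
  unfolding features_def ancestors_step[OF assms] by auto

lemma ancestors_level:
  assumes "v \<in> V" "w \<in> ancestors v"
  shows "w = v \<or> d r w < d r v"
  using assms
proof (induction "d r v" arbitrary: v)
  case 0
  then show ?case by (simp add: ancestors_def)
next
  case (Suc k)
  then have "v \<noteq> r" using d_self[OF root] by auto
  note p = parent[OF \<open>v \<in> V\<close> this]
  then show ?case using Suc.hyps(1)[of "parent v"] Suc.hyps(2) Suc.prems ancestors_step[OF \<open>v \<in> V\<close> \<open>v \<noteq> r\<close>] by auto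
qed

text \<open>
  A feature determines the level at which it arises, so a vertex has just one feature of each kind
  at its own level.
\<close>

lemma features_level:
  assumes "v \<in> V"
  shows "Inl w \<in> features v \<Longrightarrow> w = v \<or> d r w < d r v"
    and "Inr (siblings w) \<in> features v \<Longrightarrow> siblings w = siblings v \<or> d r w < d r v"
proof -
  show "w = v \<or> d r w < d r v" if "Inl w \<in> features v"
    using that ancestors_level[OF assms] unfolding features_def by auto
  show "siblings w = siblings v \<or> d r w < d r v" if feature: "Inr (siblings w) \<in> features v"
  proof -
    obtain w' where w': "w' \<in> ancestors v" "siblings w = siblings w'"
      using feature unfolding features_def by auto
    have "w \<in> siblings w" unfolding siblings_def by simp
    then have "d r w = d r w'" using w'(2) unfolding siblings_def by auto
    then show ?thesis using ancestors_level[OF assms w'(1)] w'(2) by auto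
  qed
qed

lemma siblings_eq:
  assumes "adj u v" "d r u = d r v"
  shows "siblings u = siblings v"
proof -
  have "siblings u \<subseteq> siblings v" if "adj u v" "d r u = d r v" for u v
    using that level_adjacency_transitive[OF root] unfolding siblings_def by force
  then show ?thesis using assms adj_sym by (metis subset_antisym)
qed

lemma features_adj_le_2_if_level_le:
  assumes "adj u v" "d r u \<le> d r v"
  shows "card (symdiff (features u) (features v)) \<le> 2"
proof -
  have V: "u \<in> V" "v \<in> V" using assms adj_V by blast+
  have "u \<noteq> v" using assms adj_irrefl by blast
  then have "v \<noteq> r" using assms(2) d_self[OF root] d_eq_0_iff[OF root V(1)] by auto
  note pv = parent[OF V(2) this] and fv = features_step[OF V(2) this]
  have "d r v = d r u \<or> d r v = d r u + 1" using d_step[OF root assms(1)] assms(2) by linarith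
  \<comment> \<open>An edge either joins siblings or a child to its parent.\<close>
  then obtain a b where "symdiff (features u) (features v) \<subseteq> {a, b}"
  proof
    assume lev: "d r v = d r u"
    then have "u \<noteq> r" using pv(2) d_self[OF root] by auto
    note pu = parent[OF V(1) this] and fu = features_step[OF V(1) this]
    have "parent u = parent v"
      using level_neighbours_share_lower_neighbour[OF root assms(1)] lev pu pv by metis
    then have "symdiff (features u) (features v) \<subseteq> {Inl u, Inl v}"
      unfolding fu fv siblings_eq[OF assms(1) lev[symmetric]] by auto
    then show thesis by (rule that)
  next
    assume "d r v = d r u + 1"
    then have "parent v = u" using lower_neighbour_unique[OF root pv(1) assms(1) pv(2)] by simp
    then have "symdiff (features u) (features v) \<subseteq> {Inl v, Inr (siblings v)}"
      unfolding fv by auto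
    then show thesis by (rule that)
  qed
  then have "card (symdiff (features u) (features v)) \<le> card {a, b}" by (intro card_mono) auto
  also have "\<dots> \<le> 2" by (simp add: card_insert_if)
  finally show ?thesis .
qed

lemma features_adj_le_2:
  assumes "adj u v"
  shows "card (symdiff (features u) (features v)) \<le> 2"
  using features_adj_le_2_if_level_le[OF assms] features_adj_le_2_if_level_le[OF adj_sym[OF assms]]
  by (metis Un_commute linear)

lemma features_le_dist:
  assumes "u \<in> V" "v \<in> V"
  shows "card (symdiff (features u) (features v)) \<le> 2 * d u v"
  using assms(2)
proof (induction "d u v" arbitrary: v)
  case 0
  then show ?case using d_eq_0_iff[OF assms(1)] by simp
next
  case (Suc k)
  then have "v \<noteq> u" using d_self assms(1) by auto
  then obtain x where x: "adj x v" "d u v = d u x + 1" using d_pred assms(1) Suc.prems by blast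
  then have "card (symdiff (features u) (features x)) \<le> 2 * d u x" using Suc adj_V by auto
  then show ?case
    using card_symdiff_triangle[of "features u" "features x" "features v"] features_adj_le_2[OF x(1)] x(2)
      finite_features by simp
qed

text \<open>
  Replacing the vertex of higher level by its parent shortens the distance by at most 1 and removes
  two features that the other vertex lacks, unless the two vertices are adjacent siblings.
\<close>

lemma dist_le_features:
  assumes "u \<in> V" "v \<in> V"
  shows "2 * d u v \<le> card (symdiff (features u) (features v))"
  using assms
proof (induction "d r u + d r v" arbitrary: u v rule: less_induct)
  case less
  have *: "2 * d u v \<le> card (symdiff (features u) (features v))"
    if uv: "u \<in> V" "v \<in> V" and lev: "d r v \<le> d r u" and "u \<noteq> v"
      and IH: "\<And>u' v'. d r u' + d r v' < d r u + d r v \<Longrightarrow> u' \<in> V \<Longrightarrow> v' \<in> V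
        \<Longrightarrow> 2 * d u' v' \<le> card (symdiff (features u') (features v'))" for u v
  proof -
    have "u \<noteq> r" using lev \<open>u \<noteq> v\<close> d_self[OF root] d_eq_0_iff[OF root uv(2)] by auto
    note p = parent[OF uv(1) this] and step = features_step[OF uv(1) this]
    have u_new: "Inl u \<notin> features v" using features_level(1)[OF uv(2)] lev \<open>u \<noteq> v\<close> by force
    show ?thesis
    proof (cases "Inr (siblings u) \<in> features v")
      case True
      then have eq: "siblings u = siblings v" using features_level(2)[OF uv(2)] lev by force
      have "u \<in> siblings u" unfolding siblings_def by simp
      then have "u \<in> siblings v" using eq by simp
      then have uv': "adj u v" "d r u = d r v" unfolding siblings_def using \<open>u \<noteq> v\<close> by auto
      then have "v \<noteq> r" using d_eq_0_iff[OF root] uv \<open>u \<noteq> r\<close> d_self[OF root] by metis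
      then have "Inl v \<in> features v" using features_step[OF uv(2)] by simp
      moreover have "Inl v \<notin> features u" using features_level(1)[OF uv(1)] uv'(2) \<open>u \<noteq> v\<close> by force
      ultimately have "{Inl u, Inl v} \<subseteq> symdiff (features u) (features v)"
        using u_new step by auto
      then have "card {Inl u, Inl v :: 'a + 'a set} \<le> card (symdiff (features u) (features v))"
        using finite_features by (intro card_mono) auto
      then show ?thesis using d_adj[OF uv'(1)] \<open>u \<noteq> v\<close> by simp
    next
      case False
      have "Inl u \<notin> features (parent u)" using features_level(1)[OF p(3)] p(2) by force
      moreover have "Inr (siblings u) \<notin> features (parent u)"
      proof
        assume "Inr (siblings u) \<in> features (parent u)"
        then have "siblings u = siblings (parent u)" using features_level(2)[OF p(3)] p(2) by force
        moreover have "u \<in> siblings u" unfolding siblings_def by simp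
        ultimately have "u \<in> siblings (parent u)" by simp
        then show False using p(2) unfolding siblings_def by simp
      qed
      ultimately have "symdiff (features u) (features v)
          = insert (Inl u) (insert (Inr (siblings u)) (symdiff (features (parent u)) (features v)))"
        and "Inl u \<notin> symdiff (features (parent u)) (features v)"
        and "Inr (siblings u) \<notin> symdiff (features (parent u)) (features v)"
        using step u_new False by auto
      then have "card (symdiff (features u) (features v))
          = card (symdiff (features (parent u)) (features v)) + 2"
        using finite_features by simp
      moreover have "2 * d (parent u) v \<le> card (symdiff (features (parent u)) (features v))"
        using IH[of "parent u" v] p uv by simp
      moreover have "d u v \<le> 1 + d (parent u) v"
        using d_triangle[OF uv(1) p(3) uv(2)] d_adj[OF adj_sym[OF p(1)]] by simp
      ultimately show ?thesis by simp
    qed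
  qed
  show ?case
  proof (cases "u = v")
    case True
    then show ?thesis using d_self less.prems by simp
  next
    case False
    show ?thesis
    proof (cases "d r v \<le> d r u")
      case True
      then show ?thesis using *[OF less.prems True False] less.hyps by blast
    next
      case False
      then have "2 * d v u \<le> card (symdiff (features v) (features u))"
        using *[of v u] less.prems less.hyps \<open>u \<noteq> v\<close> by (simp add: add.commute)
      then show ?thesis using d_commute less.prems by (simp add: Un_commute)
    qed
  qed
qed

lemma dist_eq_half_features:
  assumes "u \<in> V" "v \<in> V"
  shows "2 * d u v = card (symdiff (features u) (features v))"
  using features_le_dist[OF assms] dist_le_features[OF assms] by simp

end

lemma (in clique_cycle_metric) dist_conditionally_negative:
  fixes x :: "nat \<Rightarrow> real"
  assumes vs: "\<And>i. i < n \<Longrightarrow> vs i \<in> V" and zero: "(\<Sum>i<n. x i) = 0"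
  shows "(\<Sum>i<n. \<Sum>j<n. x i * x j * real (d (vs i) (vs j))) \<le> 0"
proof (cases "n = 0")
  case False
  then interpret rooted_clique_cycle_metric V adj d "vs 0"
    using vs by unfold_locales simp
  have "2 * (\<Sum>i<n. \<Sum>j<n. x i * x j * real (d (vs i) (vs j)))
      = (\<Sum>i<n. \<Sum>j<n. x i * x j * real (2 * d (vs i) (vs j)))"
    by (simp add: sum_distrib_left mult_ac)
  also have "\<dots> = (\<Sum>i<n. \<Sum>j<n. x i * x j * real (card (symdiff (features (vs i)) (features (vs j)))))"
    by (intro sum.cong refl) (simp only: dist_eq_half_features vs lessThan_iff)
  also have "\<dots> \<le> 0"
    using finite_features zero by (intro symdiff_kernel_conditionally_negative)
  finally show ?thesis by simp
qed simp

section \<open>Block graphs\<close>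

lemma connected_iff_strongly_connected:
  assumes "wf_digraph K" "symmetric K"
  shows "Digraph_Component.connected K \<longleftrightarrow> strongly_connected K"
  using wf_digraph.reachable_mk_symmetric_eq[OF assms]
  unfolding Digraph_Component.connected_def strongly_connected_def by simp

lemma successively_imp_reachable:
  assumes K: "wf_digraph K" "symmetric K"
    and "set xs \<subseteq> verts K" "successively (\<lambda>u v. u \<rightarrow>\<^bsub>K\<^esub> v) xs" "u \<in> set xs" "v \<in> set xs"
  shows "u \<rightarrow>\<^sup>*\<^bsub>K\<^esub> v"
proof -
  interpret wf_digraph K by fact
  interpret sym_digraph K using K(2) by unfold_locales
  have from_hd: "hd xs \<rightarrow>\<^sup>*\<^bsub>K\<^esub> v" if "v \<in> set xs" for v
    using that assms(3,4)
  proof (induction xs)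
    case (Cons x xs)
    show ?case
    proof (cases "v = x")
      case True
      then show ?thesis using Cons.prems by auto
    next
      case False
      then have v: "v \<in> set xs" using Cons.prems by simp
      then have "xs \<noteq> []" by auto
      then have "x \<rightarrow>\<^bsub>K\<^esub> hd xs" "successively (\<lambda>u v. u \<rightarrow>\<^bsub>K\<^esub> v) xs"
        using Cons.prems(3) by (auto simp: successively_Cons)
      then show ?thesis using Cons.IH v Cons.prems(2) by (auto intro: adj_reachable_trans)
    qed
  qed simp
  have "u \<rightarrow>\<^sup>*\<^bsub>K\<^esub> hd xs"
    using from_hd[OF assms(5)] K(2) symmetric_reachable[OF K(2)] by blast
  then show ?thesis using from_hd[OF assms(6)] by (rule reachable_trans)
qed

text \<open>
  Among the subgraphs between \<open>H\<close> and \<open>G\<close> that are connected without cut vertices, one with the largest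
  number of vertices and arcs is maximal.
\<close>

lemma ex_block_containing:
  assumes "graph G" and H: "subgraph H G" "graph H" "Digraph_Component.connected H" "\<nexists>v. cut_vertex H v"
  obtains B where "is_block G B" "subgraph H B"
proof -
  interpret graph G by fact
  define P where "P K \<longleftrightarrow> graph K \<and> Digraph_Component.connected K \<and> (\<nexists>v. cut_vertex K v)"
    for K :: "('a, 'b) pre_digraph"
  define size where "size K = card (verts K) + card (arcs K)" for K :: "('a, 'b) pre_digraph"
  let ?Q = "\<lambda>K. subgraph H K \<and> subgraph K G \<and> P K"
  have "?Q H" using H unfolding P_def by (auto simp: subgraph_def compatible_def)
  moreover have "\<forall>K. ?Q K \<longrightarrow> size K < size G + 1"
    unfolding size_def subgraph_def by (auto intro!: add_mono card_mono simp: less_Suc_eq_le)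
  ultimately obtain B where B: "?Q B" and max: "\<And>K. ?Q K \<Longrightarrow> size K \<le> size B"
    using ex_has_greatest_nat[of ?Q H size "size G + 1"] by blast
  have "\<not> (subgraph K G \<and> P K)" if "K \<noteq> B" "subgraph B K" for K
  proof
    assume K: "subgraph K G \<and> P K"
    have "subgraph H K" using B that(2) subgraph_trans by blast
    then have le: "size K \<le> size B" using max K by blast
    have sub: "verts B \<subseteq> verts K" "arcs B \<subseteq> arcs K" and tails: "tail B = tail K" "head B = head K"
      using that(2) by (auto simp: subgraph_def compatible_def)
    have fin: "finite (verts K)" "finite (arcs K)"
      using K unfolding subgraph_def by (auto intro: finite_subset)
    then have "card (verts B) \<le> card (verts K)" "card (arcs B) \<le> card (arcs K)"
      using sub by (auto intro: card_mono)
    then have "card (verts B) = card (verts K)" "card (arcs B) = card (arcs K)"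
      using le unfolding size_def by linarith+
    then have "verts B = verts K" "arcs B = arcs K"
      using card_subset_eq[OF fin(1) sub(1)] card_subset_eq[OF fin(2) sub(2)] by blast+
    then have "K = B" using tails by simp
    then show False using that(1) by blast
  qed
  then have "is_block G B"
    unfolding is_block_def max_subgraph_def using B unfolding P_def by blast
  then show thesis using B that by blast
qed

text \<open>
  The subgraph induced by a cycle stays connected when a vertex is removed, since the rest of the
  cycle is a path. It is therefore contained in a block, and the block is complete.
\<close>

lemma block_graph_cycle_clique:
  assumes G: "block_graph G"
    and c: "distinct c" "length c \<ge> 3" "successively (\<lambda>u v. u \<rightarrow>\<^bsub>G\<^esub> v) c" "last c \<rightarrow>\<^bsub>G\<^esub> hd c"
    and xy: "x \<in> set c" "y \<in> set c" "x \<noteq> y"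
  shows "x \<rightarrow>\<^bsub>G\<^esub> y"
proof -
  interpret graph G using G unfolding block_graph_def by blast
  define H where "H = G \<restriction> set c"
  have V: "set c \<subseteq> verts G"
  proof
    fix v assume "v \<in> set c"
    then obtain as bs where ab: "c = as @ v # bs" by (meson split_list)
    show "v \<in> verts G"
    proof (cases bs)
      case Nil
      then show ?thesis using c(4) ab adj_in_verts(1) by auto
    next
      case (Cons b bs')
      then have "v \<rightarrow>\<^bsub>G\<^esub> b" using c(3) ab by (simp add: successively_append_iff)
      then show ?thesis by (rule adj_in_verts(1))
    qed
  qed
  have H_adj: "u \<rightarrow>\<^bsub>H\<^esub> v \<longleftrightarrow> u \<rightarrow>\<^bsub>G\<^esub> v \<and> u \<in> set c \<and> v \<in> set c" for u v
    unfolding H_def by (auto simp: arcs_ends_conv)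
  have subH: "subgraph H G" unfolding H_def using V by (rule subgraph_induce_subgraphI)
  have "digraph H"
  proof -
    have "wf_digraph H" unfolding H_def by blast
    then interpret H: wf_digraph H .
    show ?thesis
      using V finite_subset[OF V] no_loops no_multi_arcs by unfold_locales (auto simp: H_def)
  qed
  then interpret H: digraph H .
  have symH: "symmetric H"
    using sym_arcs H_adj unfolding symmetric_def sym_def by blast
  then have graphH: "graph H" by (rule H.graphI)
  have adj_c: "successively (\<lambda>u v. u \<rightarrow>\<^bsub>H\<^esub> v) c"
    using c(3) by (rule successively_mono) (simp add: H_adj)
  have "Digraph_Component.connected H"
  proof -
    have "u \<rightarrow>\<^sup>*\<^bsub>H\<^esub> v" if "u \<in> set c" "v \<in> set c" for u v
      using successively_imp_reachable[OF _ symH _ adj_c that] H.wf_digraph_axioms by (simp add: H_def)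
    moreover have "verts H \<noteq> {}" using xy unfolding H_def by auto
    ultimately have "strongly_connected H" unfolding strongly_connected_def by (simp add: H_def)
    then show ?thesis using connected_iff_strongly_connected[OF H.wf_digraph_axioms symH] by blast
  qed
  moreover have "\<not> cut_vertex H w" for w
  proof
    assume "cut_vertex H w"
    then obtain u v where w: "w \<in> set c" and uv: "u \<in> set c - {w}" "v \<in> set c - {w}"
      and sep: "\<not> u \<rightarrow>\<^sup>*\<^bsub>pre_digraph.del_vert H w\<^esub> v"
      unfolding cut_vertex_def H_def by auto
    let ?K = "pre_digraph.del_vert H w"
    have K: "wf_digraph ?K" by (rule H.wf_digraph_del_vert)
    have K_adj: "a \<rightarrow>\<^bsub>?K\<^esub> b \<longleftrightarrow> a \<rightarrow>\<^bsub>H\<^esub> b \<and> a \<noteq> w \<and> b \<noteq> w" for a b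
      by (auto simp: arcs_ends_conv H.del_vert_simps)
    have symK: "symmetric ?K"
      using symH unfolding symmetric_def sym_def using K_adj by blast
    \<comment> \<open>Cutting the cycle open at \<open>w\<close> leaves the path \<open>bs @ as\<close>.\<close>
    obtain as bs where ab: "c = as @ w # bs" using w by (meson split_list)
    have set_ab: "set (bs @ as) = set c - {w}" using ab c(1) by auto
    have "successively (\<lambda>a b. a \<rightarrow>\<^bsub>H\<^esub> b) (bs @ as)"
    proof -
      have "successively (\<lambda>a b. a \<rightarrow>\<^bsub>H\<^esub> b) as" "successively (\<lambda>a b. a \<rightarrow>\<^bsub>H\<^esub> b) bs"
        using adj_c unfolding ab by (auto simp: successively_append_iff successively_Cons)
      moreover have "last bs \<rightarrow>\<^bsub>H\<^esub> hd as" if "as \<noteq> []" "bs \<noteq> []"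
        using c(4) that unfolding H_adj by (simp add: ab)
      ultimately show ?thesis by (auto simp: successively_append_iff)
    qed
    then have "successively (\<lambda>a b. a \<rightarrow>\<^bsub>?K\<^esub> b) (bs @ as)"
      by (rule successively_mono) (use set_ab in \<open>auto simp: K_adj\<close>)
    moreover have "set (bs @ as) \<subseteq> verts ?K"
      unfolding set_ab H.verts_del_vert by (simp add: H_def)
    ultimately have "u \<rightarrow>\<^sup>*\<^bsub>?K\<^esub> v"
      using successively_imp_reachable[OF K symK] uv set_ab by blast
    then show False using sep by blast
  qed
  ultimately obtain B where B: "is_block G B" "subgraph H B"
    using ex_block_containing[OF graph_axioms subH graphH] by blast
  have "complete_digraph (card (verts B)) B" using G B(1) unfolding block_graph_def by blast
  moreover have "x \<in> verts B" "y \<in> verts B"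
    using B(2) xy unfolding subgraph_def by (auto simp: H_def)
  ultimately have "x \<rightarrow>\<^bsub>B\<^esub> y" using xy(3) unfolding complete_digraph_def by auto
  moreover have "subgraph B G" using B(1) unfolding is_block_def max_subgraph_def by blast
  ultimately show ?thesis
    by (auto simp: subgraph_def compatible_def arcs_ends_conv)
qed

lemma block_graph_metric:
  assumes G: "block_graph G"
  obtains d where "clique_cycle_metric (verts G) (\<lambda>u v. u \<rightarrow>\<^bsub>G\<^esub> v) d"
    and "\<And>u v. u \<in> verts G \<Longrightarrow> v \<in> verts G \<Longrightarrow> graph_dist G u v = real (d u v)"
proof -
  interpret graph G using G unfolding block_graph_def by blast
  let ?\<mu> = "\<mu> (\<lambda>_. 1)"
  define d where "d u v = nat \<lfloor>graph_dist G u v\<rfloor>" for u v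
  have reach: "u \<rightarrow>\<^sup>*\<^bsub>G\<^esub> v" if "u \<in> verts G" "v \<in> verts G" for u v
    using G that connected_iff_strongly_connected[OF wf_digraph_axioms sym_arcs]
    unfolding block_graph_def strongly_connected_def by blast
  have mu: "?\<mu> u v = ereal (real (d u v))" if uv: "u \<in> verts G" "v \<in> verts G" for u v
  proof -
    obtain p where p: "?\<mu> u v = awalk_cost (\<lambda>_. 1) p"
      using min_cost_awalk[OF reach[OF uv], of "\<lambda>_. 1"] by auto
    have "awalk_cost (\<lambda>_. 1) p = real (length p)"
      by (induction p) simp_all
    then show ?thesis using p unfolding d_def graph_dist_def by simp
  qed
  have "clique_cycle_metric (verts G) (\<lambda>u v. u \<rightarrow>\<^bsub>G\<^esub> v) d"
  proof
    fix u v assume "u \<rightarrow>\<^bsub>G\<^esub> v"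
    then show "u \<in> verts G \<and> v \<in> verts G" using adj_in_verts by blast
    show "v \<rightarrow>\<^bsub>G\<^esub> u" using \<open>u \<rightarrow>\<^bsub>G\<^esub> v\<close> sym_arcs by (auto simp: symmetric_def sym_def)
  next
    fix u show "\<not> u \<rightarrow>\<^bsub>G\<^esub> u" using adj_not_same by blast
  next
    fix u assume u: "u \<in> verts G"
    then have "?\<mu> u u \<le> ereal (awalk_cost (\<lambda>_. 1) [])"
      by (intro min_cost_le_walk_cost) (simp add: awalk_Nil_iff)
    then show "d u u = 0" using mu[OF u u] by simp
  next
    fix u x y assume u: "u \<in> verts G" and xy: "x \<rightarrow>\<^bsub>G\<^esub> y"
    have V: "x \<in> verts G" "y \<in> verts G" using xy adj_in_verts by blast+
    obtain e where "e \<in> arcs G" "arc_to_ends G e = (x, y)" using xy unfolding arcs_ends_def by auto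
    then have "?\<mu> u y \<le> ?\<mu> u x + ereal 1"
      using pos_cost_mu_triangle[of "\<lambda>_. 1" e x y u] by simp
    then show "d u y \<le> d u x + 1" using mu u V by simp
  next
    fix u y assume u: "u \<in> verts G" and y: "y \<in> verts G" "y \<noteq> u"
    obtain x e where x: "?\<mu> u y = ?\<mu> u x + ereal 1" and e: "arc e (x, y)"
      using mu_exact_triangle[OF y(2) reach[OF u y(1)], of "\<lambda>_. 1"] by auto
    have xy: "x \<rightarrow>\<^bsub>G\<^esub> y" using e unfolding arc_def by (auto simp: arcs_ends_conv)
    then have "x \<in> verts G" using adj_in_verts by blast
    then have "d u y = d u x + 1" using x mu u y(1) by simp
    then show "\<exists>x. x \<rightarrow>\<^bsub>G\<^esub> y \<and> d u y = d u x + 1" using xy by blast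
  next
    fix c x y
    assume "distinct c" "length c \<ge> 3" "successively (\<lambda>u v. u \<rightarrow>\<^bsub>G\<^esub> v) c" "last c \<rightarrow>\<^bsub>G\<^esub> hd c"
      "x \<in> set c" "y \<in> set c" "x \<noteq> y"
    then show "x \<rightarrow>\<^bsub>G\<^esub> y" by (rule block_graph_cycle_clique[OF G])
  qed
  moreover have "graph_dist G u v = real (d u v)" if "u \<in> verts G" "v \<in> verts G" for u v
    unfolding graph_dist_def using mu[OF that] by simp
  ultimately show thesis by (rule that)
qed

theorem theorem4p2:
  fixes G :: "('a, 'b) pre_digraph" and vs :: "'a list" and n :: nat
  assumes "block_graph G"
    and "n = card (verts G)"
    and "n \<ge> 2"
    and "distinct vs" and "set vs = verts G"
  shows "unimodal (n - 2)
           (\<lambda>k. (-1) ^ (n - 1) * coeff (det_minus_x (distance_matrix G vs)) k)"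
proof -
  obtain d where metric: "clique_cycle_metric (verts G) (\<lambda>u v. u \<rightarrow>\<^bsub>G\<^esub> v) d"
    and dist: "\<And>u v. u \<in> verts G \<Longrightarrow> v \<in> verts G \<Longrightarrow> graph_dist G u v = real (d u v)"
    using block_graph_metric[OF assms(1)] by blast
  interpret clique_cycle_metric "verts G" "\<lambda>u v. u \<rightarrow>\<^bsub>G\<^esub> v" d by (rule metric)
  have n: "length vs = n" using assms(2,4,5) distinct_card by metis
  have vs: "vs ! i \<in> verts G" if "i < n" for i
    using that n assms(5) nth_mem by metis
  have entry: "distance_matrix G vs $$ (i, j) = real (d (vs ! i) (vs ! j))" if "i < n" "j < n" for i j
    unfolding distance_matrix_def using that n dist vs by simp
  show ?thesis
  proof (rule unimodal_if_conditionally_negative[OF _ assms(3)])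
    show "distance_matrix G vs \<in> carrier_mat n n"
      unfolding distance_matrix_def n by simp
    show "distance_matrix G vs $$ (i, j) = distance_matrix G vs $$ (j, i)" if "i < n" "j < n" for i j
      using that by (simp add: entry d_commute vs)
    show "distance_matrix G vs $$ (i, i) = 0" if "i < n" for i
      using that by (simp add: entry d_self vs)
    fix x :: "nat \<Rightarrow> real"
    assume zero: "(\<Sum>i<n. x i) = 0"
    have "(\<Sum>i<n. \<Sum>j<n. x i * x j * distance_matrix G vs $$ (i, j))
        = (\<Sum>i<n. \<Sum>j<n. x i * x j * real (d (vs ! i) (vs ! j)))"
      by (intro sum.cong refl) (simp add: entry)
    also have "\<dots> \<le> 0" by (rule dist_conditionally_negative[OF vs zero])
    finally show "(\<Sum>i<n. \<Sum>j<n. x i * x j * distance_matrix G vs $$ (i, j)) \<le> 0" .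
  qed
qed

end
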